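(* If $G$ is a special chain, then $G$ is $r$-EKR for all integers $r\geq 1$.
   Context: All graphs are finite and simple. For an integer $r\geq 1$, $\mathcal{J}^{(r)}(G)$ is the family of all independent sets of $G$ of size $r$; for $v\in V(G)$, the star centered at $v$ is $\mathcal{J}_v^{(r)}(G)=\{A\in\mathcal{J}^{(r)}(G): v\in A\}$. A family $\mathcal{A}$ of sets is intersecting if $A\cap B\neq\emptyset$ for all $A,B\in\mathcal{A}$. $G$ is $r$-EKR if no intersecting subfamily of $\mathcal{J}^{(r)}(G)$ is larger than the largest star in $\mathcal{J}^{(r)}(G)$ (this holds vacuously if $\mathcal{J}^{(r)}(G)=\emptyset$). A chain (of complete graphs) of length $n\geq 1$ is obtained from a path with vertices $v_1,\ldots,v_{n+1}$ and edges $v_iv_{i+1}$ ($1\leq i\leq n$) by replacing each edge $v_iv_{i+1}$ by a complete graph of some order $s_i\geq 2$ (the orders may differ) as follows: introduce $s_i-2$ new vertices forming a complete graph $K_{s_i-2}$ and join both $v_i$ and $v_{i+1}$ to each of these new vertices. The resulting complete graph $K_{s_i}$ on $v_i$, $v_{i+1}$ and the new vertices is called the link $G_i$, and $|G_i|=s_i$ is its number of vertices; consecutive links $G_{i-1},G_i$ share exactly the vertex $v_i$. A chain of length $0$ (trivial chain) is an isolated vertex; a chain of length $1$ is a complete graph. A chain of length $n$ is special if $n\in\{0,1\}$, or if $n\geq 2$ and both of the following hold: (1) $|G_i|\geq |G_{i-1}|+1$ for each $2\leq i\leq n-1$; (2) $|G_n|\geq |G_{n-1}|$. *)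

theory Defs
  imports "Graph_Theory.Pair_Digraph" "HOL-Library.Disjoint_Sets"
begin

text \<open>Finite simple graphs are rendered by the locale \<open>pair_graph\<close>: finite, loop-free, with every
  edge represented by both of its orientations.\<close>

definition indep_family :: "nat \<Rightarrow> 'a pair_pre_digraph \<Rightarrow> 'a set set" where
  "indep_family r G =
     {A. A \<subseteq> pverts G \<and> card A = r \<and> (\<forall>x\<in>A. \<forall>y\<in>A. (x, y) \<notin> parcs G)}"

definition star :: "nat \<Rightarrow> 'a pair_pre_digraph \<Rightarrow> 'a \<Rightarrow> 'a set set" where
  "star r G v = {A \<in> indep_family r G. v \<in> A}"

definition intersecting :: "'a set set \<Rightarrow> bool" where
  "intersecting F \<longleftrightarrow> (\<forall>A\<in>F. \<forall>B\<in>F. A \<inter> B \<noteq> {})"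

text \<open>For the empty graph, where the maximum is unspecified, \<open>r_EKR\<close> is still true for \<open>r \<ge> 1\<close>, as the
  only family to consider is then the empty one.\<close>

definition r_EKR :: "nat \<Rightarrow> 'a pair_pre_digraph \<Rightarrow> bool" where
  "r_EKR r G \<longleftrightarrow>
     (\<forall>F. F \<subseteq> indep_family r G \<and> intersecting F \<longrightarrow>
        card F \<le> Max ((\<lambda>v. card (star r G v)) ` pverts G))"

text \<open>The path vertices are \<open>v 1, \<dots>, v (n + 1)\<close>, and \<open>W i\<close> is the (possibly empty) set of new
  vertices introduced when the edge from \<open>v i\<close> to \<open>v (i + 1)\<close> is replaced by a complete graph.
  Values of \<open>v\<close> and \<open>W\<close> at other indices are irrelevant.\<close>

definition link :: "(nat \<Rightarrow> 'a) \<Rightarrow> (nat \<Rightarrow> 'a set) \<Rightarrow> nat \<Rightarrow> 'a set" where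
  "link v W i = {v i, v (i + 1)} \<union> W i"

text \<open>For \<open>n = 0\<close> the conditions say that the graph is the single vertex \<open>v 1\<close>, for \<open>n = 1\<close> that it
  is a complete graph on at least two vertices.\<close>

definition is_chain ::
  "'a pair_pre_digraph \<Rightarrow> nat \<Rightarrow> (nat \<Rightarrow> 'a) \<Rightarrow> (nat \<Rightarrow> 'a set) \<Rightarrow> bool" where
  "is_chain G n v W \<longleftrightarrow>
     pair_graph G \<and>
     inj_on v {1..n + 1} \<and>
     disjoint_family_on W {1..n} \<and>
     (\<forall>i\<in>{1..n}. W i \<inter> v ` {1..n + 1} = {}) \<and>
     pverts G = v ` {1..n + 1} \<union> (\<Union>i\<in>{1..n}. W i) \<and>
     parcs G = {(x, y). x \<noteq> y \<and> (\<exists>i\<in>{1..n}. x \<in> link v W i \<and> y \<in> link v W i)}"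

definition special_chain :: "'a pair_pre_digraph \<Rightarrow> bool" where
  "special_chain G \<longleftrightarrow>
     (\<exists>n v W. is_chain G n v W \<and>
        (n \<in> {0, 1} \<or>
         n \<ge> 2 \<and>
         (\<forall>i\<in>{2..n - 1}. card (link v W i) \<ge> card (link v W (i - 1)) + 1) \<and>
         card (link v W n) \<ge> card (link v W (n - 1))))"

end

theory Submission
  imports Defs
begin

text \<open>
  Every special chain is EKR for a reason that is uniform in the rank: the path vertex \<open>v 1\<close> at the
  end with the small links is the centre of a largest intersecting family, for every rank at once.
  In this strong form (\<open>ekr_centre\<close>) the claim can be proved by adding the links one at a time.

  Adding a link means attaching a clique \<open>B\<close> to a vertex \<open>c\<close> of the graph on \<open>V\<close> built so far, where
  the neighbourhood \<open>Q\<close> of \<open>c\<close> in \<open>V\<close> is the previous link without \<open>c\<close>, hence a clique. The size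
  conditions of a special chain give \<open>card Q \<le> card B\<close>. The heart of the proof
  (\<open>pendant_clique_ekr_centre\<close>) is that then the centre \<open>x\<close> survives, provided that it is a centre both
  of \<open>V\<close> and of \<open>V - {c}\<close>. Independent sets of rank \<open>r\<close> containing \<open>x\<close> either lie in \<open>V\<close> or
  consist of one vertex of \<open>B\<close> and a set of rank \<open>r - 1\<close> in \<open>V - {c}\<close>, so the star of \<open>x\<close> has the size
  of one star in \<open>V\<close> plus \<open>card B\<close> stars in \<open>V - {c}\<close>. An arbitrary intersecting family is therefore
  to be cut into one part that looks like an intersecting family in \<open>V\<close> and \<open>card B\<close> parts that look
  like intersecting families of rank \<open>r - 1\<close> in \<open>V - {c}\<close>.

  Fix \<open>b1 \<in> B\<close>. By compression (\<open>ex_stable_intersecting_family\<close>) the family may be assumed closed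
  under replacing any other vertex of the clique \<open>B \<union> {c}\<close> by \<open>b1\<close>. The sets that avoid
  \<open>B \<union> {c}\<close>, and those that contain \<open>b1\<close> and avoid \<open>Q\<close>, form the first part: in it \<open>b1\<close> can play the
  role of \<open>c\<close>. The other parts are indexed by the \<open>card B\<close> vertices \<open>k\<close> of \<open>B \<union> {c}\<close> other than
  \<open>b1\<close>. Part \<open>k\<close> has the sets that contain \<open>k\<close> and avoid \<open>Q\<close>, and the sets that contain a
  pair \<open>a, m k a\<close> with \<open>a \<in> Q\<close>, where the injections \<open>m k\<close> from \<open>Q\<close> to \<open>B\<close> together use every pair of
  \<open>Q \<times> B\<close>; such injections exist because \<open>card Q \<le> card B\<close> (\<open>ex_latin_array\<close>).
  Deleting the vertex of \<open>B \<union> {c}\<close> keeps part \<open>k\<close> intersecting: two of its sets with the same deleted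
  vertex either share their vertex of \<open>Q\<close>, since \<open>m k\<close> is injective, or the deleted vertex of one
  of them can be changed to \<open>b1\<close> by closure, and then the two sets must meet elsewhere.

  For the induction along the chain, both the chain with \<open>k\<close> links and this chain without its last
  path vertex are needed. The second has a shorter last link, which is why the links before
  the last one must increase strictly in size.
\<close>

section \<open>Independent sets of induced subgraphs\<close>

text \<open>All graphs in the proof are induced subgraphs of one graph, so the edge relation stays fixed and
  only the vertex set varies; edges leaving \<open>V\<close> have no effect.\<close>

definition indep_sets :: "('a \<times> 'a) set \<Rightarrow> nat \<Rightarrow> 'a set \<Rightarrow> 'a set set" where
  "indep_sets E r V = {A. A \<subseteq> V \<and> card A = r \<and> (\<forall>x\<in>A. \<forall>y\<in>A. (x, y) \<notin> E)}"

text \<open>The centre must not depend on the rank, because removing a vertex from the independent sets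
  lowers the rank by one and the stars of both ranks are added up.\<close>

definition ekr_centre :: "('a \<times> 'a) set \<Rightarrow> 'a set \<Rightarrow> 'a \<Rightarrow> bool" where
  "ekr_centre E V x \<longleftrightarrow>
     (\<forall>r F. F \<subseteq> indep_sets E r V \<longrightarrow> intersecting F \<longrightarrow>
        card F \<le> card {A \<in> indep_sets E r V. x \<in> A})"

lemma indep_family_eq_indep_sets: "indep_family r G = indep_sets (parcs G) r (pverts G)"
  by (simp add: indep_family_def indep_sets_def)

lemma intersectingD: "\<lbrakk>intersecting F; A \<in> F; B \<in> F\<rbrakk> \<Longrightarrow> A \<inter> B \<noteq> {}"
  by (simp add: intersecting_def)

lemma finite_indep_sets: "finite V \<Longrightarrow> finite (indep_sets E r V)"
  by (rule finite_subset[of _ "Pow V"]) (auto simp: indep_sets_def)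

lemma ekr_centreD:
  "\<lbrakk>ekr_centre E V x; F \<subseteq> indep_sets E r V; intersecting F\<rbrakk>
     \<Longrightarrow> card F \<le> card {A \<in> indep_sets E r V. x \<in> A}"
  by (auto simp: ekr_centre_def)

lemma r_EKR_if_ekr_centre:
  assumes "finite (pverts G)" "x \<in> pverts G" "ekr_centre (parcs G) (pverts G) x"
  shows "r_EKR r G"
  unfolding r_EKR_def
proof (intro allI impI)
  fix F assume F: "F \<subseteq> indep_family r G \<and> intersecting F"
  have "card F \<le> card (star r G x)"
    using ekr_centreD[OF assms(3), of F r] F
    by (simp add: star_def indep_family_eq_indep_sets)
  also have "\<dots> \<le> Max ((\<lambda>v. card (star r G v)) ` pverts G)"
    using assms by (intro Max_ge) auto
  finally show "card F \<le> Max ((\<lambda>v. card (star r G v)) ` pverts G)" .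
qed

lemma intersecting_indep_sets_0:
  assumes "finite V" "F \<subseteq> indep_sets E 0 V" "intersecting F"
  shows "F = {}"
proof -
  have "A = {}" if "A \<in> F" for A
  proof -
    have "A \<subseteq> V" "card A = 0" using that assms(2) by (auto simp: indep_sets_def)
    then show ?thesis using finite_subset[OF _ assms(1)] by simp
  qed
  then show ?thesis using intersectingD[OF assms(3)] by blast
qed

lemma clique_ekr_centre:
  assumes "finite V" "x \<in> V" "(x, x) \<notin> E"
    and clique: "\<And>y z. \<lbrakk>y \<in> V; z \<in> V; y \<noteq> z\<rbrakk> \<Longrightarrow> (y, z) \<in> E"
  shows "ekr_centre E V x"
  unfolding ekr_centre_def
proof (intro allI impI)
  fix r F assume F: "F \<subseteq> indep_sets E r V" "intersecting F"
  have ne: "A \<noteq> {}" if "A \<in> F" for A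
    using F(2) that by (auto simp: intersecting_def)
  have single: "\<exists>y. A = {y}" if "A \<in> F" for A
  proof -
    obtain y where "y \<in> A" using ne[OF \<open>A \<in> F\<close>] by auto
    moreover have "z = y" if "z \<in> A" for z
      using that \<open>y \<in> A\<close> \<open>A \<in> F\<close> F(1) clique by (fastforce simp: indep_sets_def)
    ultimately show ?thesis by auto
  qed
  show "card F \<le> card {A \<in> indep_sets E r V. x \<in> A}"
  proof (cases "F = {}")
    case False
    then obtain A y where A: "A \<in> F" "A = {y}" using single by blast
    have "B = A" if "B \<in> F" for B
      using single[OF that] A that F(2) by (auto simp: intersecting_def)
    then have "F = {A}" using A by blast
    moreover have "r = 1" using A F(1) by (auto simp: indep_sets_def)
    then have "{x} \<in> {A \<in> indep_sets E r V. x \<in> A}"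
      using assms by (auto simp: indep_sets_def)
    then have "0 < card {A \<in> indep_sets E r V. x \<in> A}"
      using finite_indep_sets[OF assms(1)] by (auto simp: card_gt_0_iff)
    ultimately show ?thesis by simp
  qed simp
qed

section \<open>Compression\<close>

text \<open>The classical argument for shifting \<open>w\<close> to \<open>v\<close>. A set \<open>A\<close> is moved only if its shifted version is
  not yet present, so the map is injective. A moved set still meets an unmoved set \<open>B\<close>: if they met
  only in \<open>w\<close>, then \<open>B\<close> stayed because its own shifted version is in the family, and \<open>A\<close> meets that
  version outside \<open>w\<close> and \<open>v\<close>. The set \<open>A0\<close> witnesses that the number of members
  containing \<open>v\<close> goes up.\<close>

lemma compression:
  assumes vw: "v \<noteq> w" and notboth: "\<And>A. A \<in> F \<Longrightarrow> w \<in> A \<Longrightarrow> v \<notin> A"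
    and F: "intersecting F" "finite F"
    and A0: "A0 \<in> F" "w \<in> A0" "insert v (A0 - {w}) \<notin> F"
  obtains F' where "intersecting F'" "card F' = card F"
    "card {A \<in> F. v \<in> A} < card {A \<in> F'. v \<in> A}"
    "\<And>A. A \<in> F' \<Longrightarrow> A \<in> F \<or> (\<exists>B\<in>F. w \<in> B \<and> A = insert v (B - {w}))"
proof -
  define move where "move A \<longleftrightarrow> w \<in> A \<and> insert v (A - {w}) \<notin> F" for A
  define s where "s A = (if move A then insert v (A - {w}) else A)" for A
  have meet: "s A \<inter> B \<noteq> {}" if "A \<in> F" "B \<in> F" "move A" "\<not> move B" for A B
  proof (cases "w \<in> B")
    case True
    then have "insert v (B - {w}) \<in> F" using that by (auto simp: move_def)
    then have "A \<inter> insert v (B - {w}) \<noteq> {}" using intersectingD[OF F(1)] that by blast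
    moreover have "v \<notin> A" using notboth that by (auto simp: move_def)
    ultimately show ?thesis using that by (auto simp: s_def)
  next
    case False
    have "A \<inter> B \<noteq> {}" using intersectingD[OF F(1)] that by blast
    then show ?thesis using that False by (auto simp: s_def)
  qed
  have inter: "intersecting (s ` F)"
    unfolding intersecting_def
  proof (intro ballI)
    fix X Y assume "X \<in> s ` F" "Y \<in> s ` F"
    then obtain A B where AB: "A \<in> F" "X = s A" "B \<in> F" "Y = s B" by blast
    consider "move A" "move B" | "move A" "\<not> move B" | "\<not> move A" "move B" | "\<not> move A" "\<not> move B"
      by blast
    then show "X \<inter> Y \<noteq> {}"
    proof cases
      case 1 then show ?thesis using AB by (auto simp: s_def)
    next
      case 2 then show ?thesis using AB meet[of A B] by (simp add: s_def)
    next
      case 3 then show ?thesis using AB meet[of B A] by (simp add: s_def Int_commute)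
    next
      case 4 then show ?thesis using AB intersectingD[OF F(1), of A B] by (simp add: s_def)
    qed
  qed
  have inj: "inj_on s F"
  proof (rule inj_onI)
    fix A B assume AB: "A \<in> F" "B \<in> F" "s A = s B"
    have undo: "A = insert w (s A - {v})" if "A \<in> F" "move A" for A
      using that vw notboth[of A] by (auto simp: s_def move_def)
    show "A = B"
    proof (cases "move A = move B")
      case True
      then show ?thesis
      proof (cases "move A")
        case True
        then show ?thesis using undo[of A] undo[of B] \<open>move A = move B\<close> AB by simp
      qed (use AB in \<open>auto simp: s_def\<close>)
    next
      case False
      then show ?thesis using AB by (auto simp: s_def move_def split: if_splits)
    qed
  qed
  have cnt: "s ` ({A \<in> F. v \<in> A} \<union> {A0}) \<subseteq> {A \<in> s ` F. v \<in> A}"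
    using A0 notboth by (auto simp: s_def move_def)
  have "v \<notin> A0" using A0 notboth by blast
  then have "card {A \<in> F. v \<in> A} < card ({A \<in> F. v \<in> A} \<union> {A0})"
    using F(2) by simp
  also have "\<dots> = card (s ` ({A \<in> F. v \<in> A} \<union> {A0}))"
    using A0 by (intro card_image[symmetric] inj_on_subset[OF inj]) auto
  also have "\<dots> \<le> card {A \<in> s ` F. v \<in> A}"
    using F(2) by (intro card_mono[OF _ cnt]) auto
  finally have lt: "card {A \<in> F. v \<in> A} < card {A \<in> s ` F. v \<in> A}" .
  show thesis
    by (rule that[OF inter card_image[OF inj] lt]) (auto simp: s_def move_def)
qed

text \<open>Among all intersecting families of the given size, one with the most members containing \<open>v\<close> is
  stable under every shift to \<open>v\<close>. Shifting from \<open>w\<close> preserves independence because every neighbour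
  of \<open>v\<close> other than \<open>w\<close> is a neighbour of \<open>w\<close>.\<close>

lemma ex_stable_intersecting_family:
  assumes "finite V" and F: "F \<subseteq> indep_sets E r V" "intersecting F" and v: "v \<in> V" "(v, v) \<notin> E"
    and "sym E"
    and adj: "\<And>w. w \<in> M \<Longrightarrow> w \<noteq> v \<and> (v, w) \<in> E"
    and dom: "\<And>w y. \<lbrakk>w \<in> M; y \<in> V; (v, y) \<in> E; y \<noteq> w\<rbrakk> \<Longrightarrow> (w, y) \<in> E"
  obtains F' where "F' \<subseteq> indep_sets E r V" "intersecting F'" "card F' = card F"
    "\<And>w A. \<lbrakk>w \<in> M; A \<in> F'; w \<in> A\<rbrakk> \<Longrightarrow> insert v (A - {w}) \<in> F'"
proof -
  define P where "P F' \<longleftrightarrow> F' \<subseteq> indep_sets E r V \<and> intersecting F' \<and> card F' = card F" for F'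
  have fin: "finite F'" if "P F'" for F'
    using that finite_indep_sets[OF assms(1)] by (auto simp: P_def intro: finite_subset)
  have bound: "\<forall>F'. P F' \<longrightarrow> card {A \<in> F'. v \<in> A} < Suc (card F)"
  proof (intro allI impI)
    fix F' assume F': "P F'"
    have "card {A \<in> F'. v \<in> A} \<le> card F'" by (rule card_mono[OF fin[OF F']]) blast
    then show "card {A \<in> F'. v \<in> A} < Suc (card F)" using F' by (simp add: P_def)
  qed
  have "P F" using F by (simp add: P_def)
  from ex_has_greatest_nat[of P, OF this bound]
  obtain F' where F': "P F'"
    and max: "\<And>F''. P F'' \<Longrightarrow> card {A \<in> F''. v \<in> A} \<le> card {A \<in> F'. v \<in> A}" by auto
  have ind: "A \<in> indep_sets E r V" if "A \<in> F'" for A using F' that by (auto simp: P_def)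
  have "insert v (A - {w}) \<in> F'" if w: "w \<in> M" and A: "A \<in> F'" "w \<in> A" for w A
  proof (rule ccontr)
    assume no: "insert v (A - {w}) \<notin> F'"
    have nb: "v \<notin> A" if "A \<in> F'" "w \<in> A" for A
      using ind[OF that(1)] that adj[OF w] by (auto simp: indep_sets_def)
    have "v \<noteq> w" using adj w by auto
    obtain F'' where F'': "intersecting F''" "card F'' = card F'"
      "card {A \<in> F'. v \<in> A} < card {A \<in> F''. v \<in> A}"
      "\<And>A. A \<in> F'' \<Longrightarrow> A \<in> F' \<or> (\<exists>B\<in>F'. w \<in> B \<and> A = insert v (B - {w}))"
      using compression[of v w F' A, OF \<open>v \<noteq> w\<close> nb _ fin[OF F'] A no] F' by (auto simp: P_def)
    have "insert v (B - {w}) \<in> indep_sets E r V" if B: "B \<in> F'" "w \<in> B" for B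
    proof -
      have B': "B \<subseteq> V" "card B = r" "\<forall>x\<in>B. \<forall>y\<in>B. (x, y) \<notin> E"
        using ind[OF B(1)] by (auto simp: indep_sets_def)
      have "card (insert v (B - {w})) = r"
        using B' B nb[OF B] finite_subset[OF B'(1) assms(1)] card_Suc_Diff1[of B w] by simp
      moreover have "(v, y) \<notin> E" if "y \<in> B - {w}" for y
        using dom[OF w, of y] that B B' by auto
      ultimately show ?thesis
        using B' v \<open>sym E\<close> by (auto simp: indep_sets_def dest: symD)
    qed
    then have "F'' \<subseteq> indep_sets E r V" using F''(4) ind by blast
    then have "P F''" using F' F'' by (auto simp: P_def)
    from max[OF this] show False using F''(3) by simp
  qed
  then show thesis using F' that by (auto simp: P_def)
qed

section \<open>Attaching a clique\<close>

text \<open>Some columns of the addition table modulo \<open>card B\<close>, that is, a Latin rectangle: \<open>m k\<close> sends the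
  element numbered \<open>i\<close> to the one numbered \<open>i\<close> plus the number of \<open>k\<close>.\<close>

lemma ex_latin_array:
  assumes "finite K" "finite B" "finite Q" "card K = card B" "card Q \<le> card B"
  obtains m where "\<And>k. k \<in> K \<Longrightarrow> inj_on (m k) Q" "\<And>k a. \<lbrakk>k \<in> K; a \<in> Q\<rbrakk> \<Longrightarrow> m k a \<in> B"
    "\<And>a b. \<lbrakk>a \<in> Q; b \<in> B\<rbrakk> \<Longrightarrow> \<exists>k\<in>K. m k a = b"
proof -
  define q where "q = card B"
  obtain \<phi> where \<phi>: "bij_betw \<phi> K {0..<q}"
    using ex_bij_betw_finite_nat[OF assms(1)] assms by (auto simp: q_def)
  obtain \<psi> where \<psi>: "bij_betw \<psi> {0..<q} B"
    using ex_bij_betw_nat_finite[OF assms(2)] by (auto simp: q_def)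
  obtain \<gamma> where \<gamma>: "bij_betw \<gamma> Q {0..<card Q}"
    using ex_bij_betw_finite_nat[OF assms(3)] by auto
  have \<gamma>q: "\<gamma> a < q" if "a \<in> Q" for a
    using bij_betwE[OF \<gamma>] that assms(5) by (fastforce simp: q_def)
  define m where "m k a = \<psi> ((\<phi> k + \<gamma> a) mod q)" for k a
  have "inj_on (m k) Q" for k
  proof (rule inj_onI)
    fix a a' assume a: "a \<in> Q" "a' \<in> Q" "m k a = m k a'"
    have "0 < q" using \<gamma>q[OF a(1)] by simp
    then have "(\<phi> k + \<gamma> a) mod q = (\<phi> k + \<gamma> a') mod q"
      using a(3) bij_betw_imp_inj_on[OF \<psi>] by (auto simp: m_def inj_on_def)
    then have "int q dvd int (\<gamma> a) - int (\<gamma> a')"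
      by (metis add_diff_cancel_left mod_eq_dvd_iff of_nat_add of_nat_mod)
    then have "\<gamma> a mod q = \<gamma> a' mod q"
      by (metis mod_eq_dvd_iff of_nat_eq_iff of_nat_mod)
    then have "\<gamma> a = \<gamma> a'" using \<gamma>q a by simp
    then show "a = a'" using a bij_betw_imp_inj_on[OF \<gamma>] by (auto simp: inj_on_def)
  qed
  moreover have "m k a \<in> B" if "a \<in> Q" for k a
    using \<gamma>q[OF that] bij_betwE[OF \<psi>] by (auto simp: m_def)
  moreover have "\<exists>k\<in>K. m k a = b" if "a \<in> Q" "b \<in> B" for a b
  proof -
    obtain j where j: "j < q" "\<psi> j = b"
      using bij_betw_imp_surj_on[OF \<psi>] \<open>b \<in> B\<close> by (metis atLeastLessThan_iff imageE)
    have "(j + (q - \<gamma> a)) mod q \<in> {0..<q}" using j by simp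
    then obtain k where k: "k \<in> K" "\<phi> k = (j + (q - \<gamma> a)) mod q"
      using bij_betw_imp_surj_on[OF \<phi>] by (metis imageE)
    have "(\<phi> k + \<gamma> a) mod q = (j + (q - \<gamma> a) + \<gamma> a) mod q"
      using k by (simp add: mod_add_left_eq)
    also have "\<dots> = j" using j \<gamma>q[OF \<open>a \<in> Q\<close>] by simp
    finally show ?thesis using k(1) j(2) by (intro bexI[of _ k]) (simp_all add: m_def)
  qed
  ultimately show thesis using that by blast
qed

text \<open>A vertex of \<open>B\<close> can be added to any independent set that avoids \<open>c\<close>, since \<open>c\<close> is the only vertex
  of \<open>V\<close> which may have neighbours in \<open>B\<close>.\<close>

lemma pendant_clique_star_ge:
  assumes fin: "finite V" "finite B" and disj: "V \<inter> B = {}" and x: "x \<noteq> c" "x \<in> V"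
    and irr: "\<And>y. (y, y) \<notin> E" and "sym E"
    and far: "\<And>b y. \<lbrakk>b \<in> B; y \<in> V; y \<noteq> c\<rbrakk> \<Longrightarrow> (b, y) \<notin> E"
  shows "card {A \<in> indep_sets E (Suc r) V. x \<in> A}
           + card B * card {A \<in> indep_sets E r (V - {c}). x \<in> A}
         \<le> card {A \<in> indep_sets E (Suc r) (V \<union> B). x \<in> A}"
proof -
  let ?S = "{A \<in> indep_sets E (Suc r) V. x \<in> A}"
  let ?T = "{A \<in> indep_sets E r (V - {c}). x \<in> A}"
  define g where "g = (\<lambda>(b, A). insert (b::'a) A)"
  have inj: "inj_on g (B \<times> ?T)"
  proof (rule inj_onI)
    fix p p' assume p: "p \<in> B \<times> ?T" "p' \<in> B \<times> ?T" "g p = g p'"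
    obtain b A b' A' where [simp]: "p = (b, A)" "p' = (b', A')" by fastforce
    have AA: "A \<subseteq> V" "A' \<subseteq> V" "b \<in> B" "b' \<in> B" using p by (auto simp: indep_sets_def)
    have "A = insert b A \<inter> V" "A' = insert b' A' \<inter> V" using AA disj by auto
    moreover have "{b} = insert b A \<inter> B" "{b'} = insert b' A' \<inter> B" using AA disj by auto
    moreover have "insert b A = insert b' A'" using p by (simp add: g_def)
    ultimately show "p = p'" by (metis \<open>p = (b, A)\<close> \<open>p' = (b', A')\<close> the_elem_eq)
  qed
  have sub: "?S \<union> g ` (B \<times> ?T) \<subseteq> {A \<in> indep_sets E (Suc r) (V \<union> B). x \<in> A}"
  proof -
    have "insert b A \<in> indep_sets E (Suc r) (V \<union> B)"
      if b: "b \<in> B" and A: "A \<in> indep_sets E r (V - {c})" for b A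
    proof -
      have A': "A \<subseteq> V - {c}" "card A = r" "\<forall>x\<in>A. \<forall>y\<in>A. (x, y) \<notin> E"
        using A by (auto simp: indep_sets_def)
      have "b \<notin> A" using A' b disj by auto
      moreover have "finite A" using A' fin by (auto intro: finite_subset)
      moreover have "(b, y) \<notin> E" "(y, b) \<notin> E" if "y \<in> A" for y
        using far[OF b, of y] that A' \<open>sym E\<close> by (auto dest: symD)
      ultimately show ?thesis using A' b irr by (auto simp: indep_sets_def)
    qed
    then show ?thesis by (auto simp: g_def) (auto simp: indep_sets_def)
  qed
  have "A \<notin> ?S" if "A \<in> g ` (B \<times> ?T)" for A
    using that disj by (auto simp: g_def indep_sets_def)
  then have dis: "?S \<inter> g ` (B \<times> ?T) = {}" by blast
  have fins: "finite ?S" "finite (B \<times> ?T)"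
    using fin by (simp_all add: finite_indep_sets)
  have "card ?S + card B * card ?T = card ?S + card (g ` (B \<times> ?T))"
    using card_image[OF inj] by (simp add: card_cartesian_product)
  also have "\<dots> = card (?S \<union> g ` (B \<times> ?T))"
    using fins by (intro card_Un_disjoint[symmetric] dis) auto
  also have "\<dots> \<le> card {A \<in> indep_sets E (Suc r) (V \<union> B). x \<in> A}"
    using finite_indep_sets[of "V \<union> B" E "Suc r"] fin by (intro card_mono[OF _ sub]) auto
  finally show ?thesis .
qed

text \<open>The induction step, for which the families \<open>P\<close> and \<open>X k\<close> below are the parts described at the
  beginning. The condition \<open>x \<noteq> c\<close> makes \<open>x\<close> a vertex of \<open>V - {c}\<close> and not adjacent to \<open>B\<close>.\<close>

lemma pendant_clique_ekr_centre:
  assumes fin: "finite V" "finite B" and disj: "V \<inter> B = {}"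
    and c: "c \<in> V" and x: "x \<in> V" "x \<noteq> c"
    and irr: "\<And>y. (y, y) \<notin> E" and "sym E"
    and Q: "\<And>y. y \<in> V \<Longrightarrow> (c, y) \<in> E \<longleftrightarrow> y \<in> Q" "Q \<subseteq> V"
    and Qclique: "\<And>y z. \<lbrakk>y \<in> Q; z \<in> Q; y \<noteq> z\<rbrakk> \<Longrightarrow> (y, z) \<in> E"
    and Bclique: "\<And>y z. \<lbrakk>y \<in> insert c B; z \<in> insert c B; y \<noteq> z\<rbrakk> \<Longrightarrow> (y, z) \<in> E"
    and far: "\<And>b y. \<lbrakk>b \<in> B; y \<in> V; y \<noteq> c\<rbrakk> \<Longrightarrow> (b, y) \<notin> E"
    and le: "card Q \<le> card B"
    and ekr: "ekr_centre E V x" "ekr_centre E (V - {c}) x"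
  shows "ekr_centre E (V \<union> B) x"
proof (cases "B = {}")
  case True
  then show ?thesis using ekr by simp
next
  case False
  then obtain b1 where b1: "b1 \<in> B" by blast
  define L where "L = insert c B"
  define K where "K = L - {b1}"
  have cB: "c \<notin> B" using c disj by auto
  have cQ: "c \<notin> Q" using Q(1)[OF c] irr by auto
  have QB: "Q \<inter> B = {}" using Q(2) disj by auto
  have finL: "finite L" "finite K" "finite Q"
    using fin Q(2) by (auto simp: L_def K_def intro: finite_subset)
  have cardK: "card K = card B" using b1 cB fin by (simp add: K_def L_def)
  obtain m where m: "\<And>k. k \<in> K \<Longrightarrow> inj_on (m k) Q" "\<And>k a. \<lbrakk>k \<in> K; a \<in> Q\<rbrakk> \<Longrightarrow> m k a \<in> B"
    "\<And>a b. \<lbrakk>a \<in> Q; b \<in> B\<rbrakk> \<Longrightarrow> \<exists>k\<in>K. m k a = b"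
    using ex_latin_array[OF finL(2) fin(2) finL(3) cardK le] by blast
  \<comment> \<open>For \<open>T\<close> in the \<open>k\<close>-th part with its vertex of \<open>L\<close> deleted, \<open>e k T\<close> is that deleted vertex:
    it depends on \<open>T\<close> and \<open>k\<close> only, which makes the deletion injective on each part.\<close>
  define e where "e k T = (if T \<inter> Q = {} then k else m k (the_elem (T \<inter> Q)))" for k T
  show ?thesis
    unfolding ekr_centre_def
  proof (intro allI impI)
    fix r F0 assume F0: "F0 \<subseteq> indep_sets E r (V \<union> B)" "intersecting F0"
    show "card F0 \<le> card {A \<in> indep_sets E r (V \<union> B). x \<in> A}"
    proof (cases r)
      case 0
      then have "F0 = {}" using intersecting_indep_sets_0[of "V \<union> B" F0 E] F0 fin by auto
      then show ?thesis by simp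
    next
      case (Suc r')
      have dom: "(w, y) \<in> E" if "w \<in> K" "y \<in> V \<union> B" "(b1, y) \<in> E" "y \<noteq> w" for w y
      proof -
        have "y \<in> insert c B" using far[OF b1, of y] that by auto
        then show ?thesis using Bclique[of w y] that by (auto simp: K_def L_def)
      qed
      have adj: "w \<noteq> b1 \<and> (b1, w) \<in> E" if "w \<in> K" for w
        using that b1 Bclique[of b1 w] by (auto simp: K_def L_def)
      have "b1 \<in> V \<union> B" using b1 by simp
      obtain F where F: "F \<subseteq> indep_sets E r (V \<union> B)" "intersecting F" "card F = card F0"
        and stable: "\<And>w A. \<lbrakk>w \<in> K; A \<in> F; w \<in> A\<rbrakk> \<Longrightarrow> insert b1 (A - {w}) \<in> F"
        using ex_stable_intersecting_family[of "V \<union> B" F0 E r b1 K, OF _ F0 \<open>b1 \<in> V \<union> B\<close> irr \<open>sym E\<close> adj dom]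
          fin by blast
      have finF: "finite F" using F(1) finite_indep_sets[of "V \<union> B"] fin by (auto intro: finite_subset)
      have FD: "A \<subseteq> V \<union> B" "card A = r" "\<And>y z. \<lbrakk>y \<in> A; z \<in> A\<rbrakk> \<Longrightarrow> (y, z) \<notin> E" "finite A"
        if "A \<in> F" for A
      proof -
        have "A \<in> indep_sets E r (V \<union> B)" using that F by blast
        then show "A \<subseteq> V \<union> B" "card A = r" "\<And>y z. \<lbrakk>y \<in> A; z \<in> A\<rbrakk> \<Longrightarrow> (y, z) \<notin> E"
          by (auto simp: indep_sets_def)
        then show "finite A" using fin by (auto intro: finite_subset)
      qed
      have meet: "A \<inter> A' \<noteq> {}" if "A \<in> F" "A' \<in> F" for A A'
        using that intersectingD[OF F(2)] by blast
      have L1: "y = z" if "A \<in> F" "y \<in> A" "z \<in> A" "y \<in> L" "z \<in> L" for A y z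
        using FD(3)[OF that(1-3)] Bclique[of y z] that by (auto simp: L_def)
      have Q1: "y = z" if "A \<in> F" "y \<in> A" "z \<in> A" "y \<in> Q" "z \<in> Q" for A y z
        using FD(3)[OF that(1-3)] Qclique[of y z] that by auto

      define P where "P = {A \<in> F. A \<inter> L = {} \<or> b1 \<in> A \<and> A \<inter> Q = {}}"
      define X where "X k = {A \<in> F. A \<inter> L = {e k (A - L)}}" for k

      have cover: "F \<subseteq> P \<union> (\<Union>k\<in>K. X k)"
      proof
        fix A assume A: "A \<in> F"
        show "A \<in> P \<union> (\<Union>k\<in>K. X k)"
        proof (cases "A \<inter> L = {}")
          case True
          then show ?thesis using A by (auto simp: P_def)
        next
          case False
          then obtain z where z: "z \<in> A" "z \<in> L" by auto
          then have AL: "A \<inter> L = {z}" using L1[OF A] by blast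
          have AQ: "(A - L) \<inter> Q = A \<inter> Q" using QB cQ by (auto simp: L_def)
          show ?thesis
          proof (cases "A \<inter> Q = {}")
            case True
            show ?thesis
            proof (cases "z = b1")
              case True
              then show ?thesis using A z \<open>A \<inter> Q = {}\<close> by (auto simp: P_def)
            next
              case False
              then have "z \<in> K" using z by (auto simp: K_def)
              moreover have "A \<in> X z" using A AL AQ True by (simp add: X_def e_def)
              ultimately show ?thesis by blast
            qed
          next
            case False
            then obtain a where a: "a \<in> A" "a \<in> Q" by auto
            then have Aa: "A \<inter> Q = {a}" using Q1[OF A] by blast
            have "z \<noteq> c" using FD(3)[OF A z(1) a(1)] Q a by auto
            then have "z \<in> B" using z by (auto simp: L_def)
            then obtain k where k: "k \<in> K" "m k a = z" using m(3)[OF a(2)] by blast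
            then have "A \<in> X k" using A AL AQ Aa by (simp add: X_def e_def)
            then show ?thesis using k by blast
          qed
        qed
      qed

      have cardP: "card P \<le> card {A \<in> indep_sets E (Suc r') V. x \<in> A}"
      proof -
        \<comment> \<open>Members of \<open>P\<close> contain no vertex of \<open>Q\<close> next to \<open>b1\<close>, so \<open>c\<close> can take the place of
          \<open>b1\<close>, and this turns \<open>P\<close> into a family on \<open>V\<close>.\<close>
        define t where "t A = (if b1 \<in> A then insert c (A - {b1}) else A)" for A
        have PD: "A \<in> F" "c \<notin> A" "A \<inter> B \<subseteq> {b1}" "b1 \<in> A \<Longrightarrow> A \<inter> Q = {}" if "A \<in> P" for A
        proof -
          have "b1 \<in> L" "b1 \<noteq> c" using b1 cB by (auto simp: L_def)
          show "A \<in> F" using that by (simp add: P_def)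
          then have "A \<inter> L \<subseteq> {b1}" using that L1[of A b1] \<open>b1 \<in> L\<close> by (fastforce simp: P_def)
          then show "c \<notin> A" "A \<inter> B \<subseteq> {b1}" using \<open>b1 \<noteq> c\<close> by (auto simp: L_def)
          show "A \<inter> Q = {}" if "b1 \<in> A"
            using that \<open>A \<in> P\<close> \<open>b1 \<in> L\<close> by (auto simp: P_def)
        qed
        have inj: "inj_on t P"
        proof (rule inj_onI)
          fix A A' assume "A \<in> P" "A' \<in> P" "t A = t A'"
          then show "A = A'" using PD(2)[of A] PD(2)[of A'] b1 cB
            by (auto simp: t_def split: if_splits)
        qed
        have sub: "t ` P \<subseteq> indep_sets E (Suc r') V"
        proof
          fix T assume "T \<in> t ` P"
          then obtain A where A: "A \<in> P" "T = t A" by blast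
          note A' = PD[OF A(1)] FD[OF PD(1)[OF A(1)]]
          show "T \<in> indep_sets E (Suc r') V"
          proof (cases "b1 \<in> A")
            case True
            have "card T = r"
              using A A' True card_Suc_Diff1[of A b1] by (simp add: t_def)
            moreover have AV: "A - {b1} \<subseteq> V" using A' by auto
            moreover have cA: "(c, y) \<notin> E" "(y, c) \<notin> E" if "y \<in> A - {b1}" for y
              using that AV A'(4)[OF True] Q(1)[of y] \<open>sym E\<close> by (auto dest: symD)
            ultimately show ?thesis using A A'(7) True c irr Suc
              by (auto simp: t_def indep_sets_def)
          next
            case False
            then show ?thesis using A A' Suc by (auto simp: t_def indep_sets_def)
          qed
        qed
        have "intersecting (t ` P)"
          unfolding intersecting_def
        proof (intro ballI)
          fix T T' assume "T \<in> t ` P" "T' \<in> t ` P"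
          then obtain A A' where A: "A \<in> P" "T = t A" "A' \<in> P" "T' = t A'" by blast
          obtain y where "y \<in> A" "y \<in> A'" using meet[of A A'] PD(1) A by auto
          then show "T \<inter> T' \<noteq> {}" using A by (auto simp: t_def)
        qed
        from ekr_centreD[OF ekr(1) sub this] show ?thesis using card_image[OF inj] by simp
      qed

      have cardX: "card (X k) \<le> card {A \<in> indep_sets E r' (V - {c}). x \<in> A}" if k: "k \<in> K" for k
      proof -
        define D where "D = (\<lambda>A. A - L) ` X k"
        have restore: "A = insert (e k (A - L)) (A - L)" if "A \<in> X k" for A
          using that by (auto simp: X_def)
        then have inj: "inj_on (\<lambda>A. A - L) (X k)" by (metis (no_types, lifting) inj_onI)
        have DD: "insert (e k T) T \<in> F" "T \<inter> L = {}" "e k T \<in> L" if "T \<in> D" for T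
          using that restore by (auto simp: D_def X_def)
        have sub: "D \<subseteq> indep_sets E r' (V - {c})"
        proof
          fix T assume T: "T \<in> D"
          note T' = DD[OF T] FD[OF DD(1)[OF T]]
          have "e k T \<notin> T" using T' by auto
          then have "card T = r'" using T'(5,7) Suc by simp
          moreover have "T \<subseteq> V - {c}" using T' by (auto simp: L_def)
          ultimately show "T \<in> indep_sets E r' (V - {c})"
            using T'(6) by (auto simp: indep_sets_def)
        qed
        have one: "\<exists>a. T \<inter> Q = {a}" if "T \<in> D" "T \<inter> Q \<noteq> {}" for T
          using that Q1[OF DD(1)[OF that(1)]] by blast
        have diffb: "T \<inter> T' \<noteq> {}"
          if "insert z T \<in> F" "insert z' T' \<in> F" "z \<noteq> z'" "z \<in> L" "z' \<in> L" "T \<inter> L = {}" "T' \<inter> L = {}"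
          for z z' T T'
          using meet[OF that(1,2)] that by auto
        \<comment> \<open>The only use of stability: \<open>T\<close> also extends by \<open>b1\<close> to a member of \<open>F\<close>, and \<open>b1\<close> differs
          from the vertex \<open>k\<close> that extends \<open>T'\<close>.\<close>
        have same: "T \<inter> T' \<noteq> {}" if T: "T \<in> D" "T' \<in> D" "e k T = e k T'" "T \<inter> Q = {}" for T T'
        proof -
          have ek: "e k T = k" using T by (simp add: e_def)
          have "insert b1 (insert k T - {k}) \<in> F"
            using stable[OF k DD(1)[OF T(1)]] ek by simp
          moreover have "insert k T - {k} = T" using DD(2)[OF T(1)] k by (auto simp: K_def)
          ultimately have "insert b1 T \<in> F" by simp
          moreover have "insert k T' \<in> F" using DD(1)[OF T(2)] T(3) ek by simp
          moreover have "b1 \<noteq> k" "b1 \<in> L" "k \<in> L" using k b1 by (auto simp: K_def L_def)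
          ultimately show ?thesis
            using diffb[of b1 T k T'] DD(2)[OF T(1)] DD(2)[OF T(2)] by blast
        qed
        have "intersecting D"
          unfolding intersecting_def
        proof (intro ballI)
          fix T T' assume T: "T \<in> D" "T' \<in> D"
          show "T \<inter> T' \<noteq> {}"
          proof (cases "e k T = e k T'")
            case False
            then show ?thesis using diffb[OF DD(1)[OF T(1)] DD(1)[OF T(2)]] DD[OF T(1)] DD[OF T(2)] by blast
          next
            case eq: True
            show ?thesis
            proof (cases "T \<inter> Q = {} \<or> T' \<inter> Q = {}")
              case True
              then show ?thesis using same[OF T eq] same[OF T(2,1)] eq by auto
            next
              case False
              then obtain a a' where a: "T \<inter> Q = {a}" "T' \<inter> Q = {a'}" using one T by meson
              then have "m k a = m k a'" using eq by (simp add: e_def)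
              then have "a = a'" using m(1)[OF k] a by (auto simp: inj_on_def)
              then show ?thesis using a by auto
            qed
          qed
        qed
        from ekr_centreD[OF ekr(2) sub this] show ?thesis
          using card_image[OF inj] by (simp add: D_def)
      qed

      have "card F \<le> card (P \<union> (\<Union>k\<in>K. X k))"
        using finF by (intro card_mono[OF _ cover]) (auto simp: P_def X_def finL)
      also have "\<dots> \<le> card P + (\<Sum>k\<in>K. card (X k))"
        using card_Un_le[of P "\<Union>k\<in>K. X k"] card_UN_le[OF finL(2), of X] by linarith
      also have "\<dots> \<le> card {A \<in> indep_sets E (Suc r') V. x \<in> A}
                        + card B * card {A \<in> indep_sets E r' (V - {c}). x \<in> A}"
        using cardP sum_bounded_above[of K "\<lambda>k. card (X k)", OF cardX] cardK by (intro add_mono) simp_all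
      also have "\<dots> \<le> card {A \<in> indep_sets E (Suc r') (V \<union> B). x \<in> A}"
        by (rule pendant_clique_star_ge[OF fin disj x(2,1) irr \<open>sym E\<close> far])
      finally show ?thesis using F(3) Suc by simp
    qed
  qed
qed

section \<open>Special chains\<close>

lemma is_chainD:
  assumes "is_chain G n v W"
  shows chain_inj: "\<lbrakk>v a = v b; a \<in> {1..n + 1}; b \<in> {1..n + 1}\<rbrakk> \<Longrightarrow> a = b"
    and chain_W_v: "\<lbrakk>a \<in> {1..n + 1}; i \<in> {1..n}\<rbrakk> \<Longrightarrow> v a \<notin> W i"
    and chain_W_disjoint: "\<lbrakk>i \<in> {1..n}; j \<in> {1..n}; i \<noteq> j\<rbrakk> \<Longrightarrow> W i \<inter> W j = {}"
    and chain_verts: "pverts G = v ` {1..n + 1} \<union> (\<Union>i\<in>{1..n}. W i)"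
    and chain_arcs: "(y, z) \<in> parcs G \<longleftrightarrow>
      y \<noteq> z \<and> (\<exists>i\<in>{1..n}. y \<in> link v W i \<and> z \<in> link v W i)"
    and finite_chain_verts: "finite (pverts G)"
    and finite_chain_link: "i \<in> {1..n} \<Longrightarrow> finite (link v W i)"
proof -
  note chain = assms[unfolded is_chain_def]
  have graph: "pair_graph G" using chain by (elim conjE)
  have inj: "inj_on v {1..n + 1}" using chain by (elim conjE)
  have disj: "disjoint_family_on W {1..n}" using chain by (elim conjE)
  have Wv: "\<forall>i\<in>{1..n}. W i \<inter> v ` {1..n + 1} = {}" using chain by (elim conjE)
  have V: "pverts G = v ` {1..n + 1} \<union> (\<Union>i\<in>{1..n}. W i)" using chain by (elim conjE)
  have E: "parcs G = {(x, y). x \<noteq> y \<and> (\<exists>i\<in>{1..n}. x \<in> link v W i \<and> y \<in> link v W i)}"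
    using chain by (elim conjE)
  show "\<lbrakk>v a = v b; a \<in> {1..n + 1}; b \<in> {1..n + 1}\<rbrakk> \<Longrightarrow> a = b"
    by (rule inj_onD[OF inj])
  show "\<lbrakk>a \<in> {1..n + 1}; i \<in> {1..n}\<rbrakk> \<Longrightarrow> v a \<notin> W i" using Wv by blast
  show "\<lbrakk>i \<in> {1..n}; j \<in> {1..n}; i \<noteq> j\<rbrakk> \<Longrightarrow> W i \<inter> W j = {}"
    using disj unfolding disjoint_family_on_def by blast
  show "pverts G = v ` {1..n + 1} \<union> (\<Union>i\<in>{1..n}. W i)" by (rule V)
  show "(y, z) \<in> parcs G \<longleftrightarrow> y \<noteq> z \<and> (\<exists>i\<in>{1..n}. y \<in> link v W i \<and> z \<in> link v W i)"
    by (simp add: E)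
  interpret pair_graph G by (rule graph)
  show "finite (pverts G)" by (rule pair_finite_verts)
  moreover have "link v W i \<subseteq> pverts G" if "i \<in> {1..n}"
    unfolding V link_def using that by auto
  ultimately show "i \<in> {1..n} \<Longrightarrow> finite (link v W i)" using finite_subset by blast
qed

lemma chain_links_inter:
  assumes G: "is_chain G n v W" and ij: "1 \<le> i" "i < j" "j \<le> n"
    and y: "y \<in> link v W i" "y \<in> link v W j"
  shows "j = Suc i \<and> y = v (Suc i)"
proof -
  note inj = chain_inj[OF G] and W = chain_W_v[OF G]
  have "W i \<inter> W j = {}" using chain_W_disjoint[OF G, of i j] ij by simp
  then have "\<exists>a\<in>{i, Suc i}. \<exists>b\<in>{j, Suc j}. y = v a \<and> y = v b"
    using y ij W[of i j] W[of "Suc i" j] W[of j i] W[of "Suc j" i] by (auto simp: link_def)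
  then obtain a b where ab: "a \<in> {i, Suc i}" "b \<in> {j, Suc j}" "y = v a" "y = v b" by blast
  then have "a = b" using inj[of a b] ij by auto
  then show ?thesis using ab ij by auto
qed

text \<open>In the chain of the first \<open>k\<close> links the last path vertex \<open>v (Suc k)\<close> is adjacent exactly to
  the rest of link \<open>k\<close>, so a part of link \<open>Suc k\<close> is attached there as a pendant clique. Allowing a
  part \<open>B\<close> instead of the whole link covers the chain from which the next path vertex has been
  removed.\<close>

lemma chain_attach_to_link:
  assumes G: "is_chain G n v W" and k: "1 \<le> k" "k < n"
    and B: "B \<subseteq> link v W (Suc k) - {v (Suc k)}"
    and le: "card (link v W k - {v (Suc k)}) \<le> card B"
  defines "U \<equiv> \<Union>i\<in>{1..k}. link v W i"
  assumes ekr: "ekr_centre (parcs G) U (v 1)" "ekr_centre (parcs G) (U - {v (Suc k)}) (v 1)"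
  shows "ekr_centre (parcs G) (U \<union> B) (v 1)"
proof -
  let ?c = "v (Suc k)"
  note inj = chain_inj[OF G] and arcs = chain_arcs[OF G] and finlink = finite_chain_link[OF G]
  have c: "?c \<in> link v W k" "?c \<in> link v W (Suc k)" by (auto simp: link_def)
  have onlyc: "y = ?c" if "i \<in> {1..k}" "y \<in> link v W i" "j \<in> {Suc k..n}" "y \<in> link v W j" for i j y
    using chain_links_inter[OF G, of i j y] that by auto
  have clinks: "i \<in> {k, Suc k}" if "i \<in> {1..n}" "?c \<in> link v W i" for i
  proof (rule ccontr)
    assume "i \<notin> {k, Suc k}"
    then consider "i < k" | "Suc k < i" by force
    then show False
    proof cases
      case 1
      then show False using chain_links_inter[OF G, of i k ?c] that c k inj[of "Suc k" "Suc i"] by auto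
    next
      case 2
      then show False
        using chain_links_inter[OF G, of "Suc k" i ?c] that c inj[of "Suc k" "Suc (Suc k)"] by auto
    qed
  qed
  have "finite U" using finlink k by (auto simp: U_def)
  moreover have "finite B" using finlink[of "Suc k"] k B by (auto intro: finite_subset)
  moreover have "U \<inter> B = {}"
  proof -
    have "y = ?c" if "y \<in> U" "y \<in> B" for y
      using onlyc[of _ y "Suc k"] that B k unfolding U_def by (metis DiffD1 UN_E atLeastAtMost_iff order_refl subsetD Suc_leI)
    then show ?thesis using B by blast
  qed
  moreover have "?c \<in> U" using c k by (auto simp: U_def)
  moreover have "v 1 \<in> U" using k by (auto simp: U_def link_def intro!: bexI[of _ 1])
  moreover have "v 1 \<noteq> ?c" using inj[of 1 "Suc k"] k by auto
  moreover have "(y, y) \<notin> parcs G" for y by (simp add: arcs)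
  moreover have "sym (parcs G)" by (auto simp: sym_def arcs)
  moreover have "(?c, y) \<in> parcs G \<longleftrightarrow> y \<in> link v W k - {?c}" if yU: "y \<in> U" for y
  proof
    assume "(?c, y) \<in> parcs G"
    then obtain i where i: "?c \<noteq> y" "i \<in> {1..n}" "?c \<in> link v W i" "y \<in> link v W i"
      by (auto simp: arcs)
    obtain j where j: "j \<in> {1..k}" "y \<in> link v W j" using yU by (auto simp: U_def)
    have "i \<noteq> Suc k" using onlyc[OF j, of i] i by auto
    then show "y \<in> link v W k - {?c}" using clinks[OF i(2,3)] i by auto
  next
    assume "y \<in> link v W k - {?c}"
    then show "(?c, y) \<in> parcs G" using c k by (auto simp: arcs intro!: bexI[of _ k])
  qed
  moreover have "link v W k - {?c} \<subseteq> U" using k by (auto simp: U_def)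
  moreover have "(y, z) \<in> parcs G"
    if "y \<in> link v W k - {?c}" "z \<in> link v W k - {?c}" "y \<noteq> z" for y z
    using that k by (auto simp: arcs intro!: bexI[of _ k])
  moreover have "(y, z) \<in> parcs G" if "y \<in> insert ?c B" "z \<in> insert ?c B" "y \<noteq> z" for y z
  proof -
    have "y \<in> link v W (Suc k)" "z \<in> link v W (Suc k)" using that c B by auto
    then show ?thesis using that k by (auto simp: arcs intro!: bexI[of _ "Suc k"])
  qed
  moreover have "(b, y) \<notin> parcs G" if b: "b \<in> B" and y: "y \<in> U" "y \<noteq> ?c" for b y
  proof
    assume "(b, y) \<in> parcs G"
    then obtain i where i: "i \<in> {1..n}" "b \<in> link v W i" "y \<in> link v W i" by (auto simp: arcs)
    have b': "b \<in> link v W (Suc k)" "b \<noteq> ?c" using b B by auto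
    obtain j where j: "j \<in> {1..k}" "y \<in> link v W j" using y by (auto simp: U_def)
    show False
    proof (cases "i \<le> k")
      case True
      then show False using onlyc[of i b "Suc k"] i b' k by auto
    next
      case False
      then show False using onlyc[OF j, of i] i y by auto
    qed
  qed
  ultimately show ?thesis using le ekr by (rule pendant_clique_ekr_centre)
qed

text \<open>The step to \<open>Suc k\<close> attaches to the chain of \<open>k\<close> links either all of link \<open>Suc k\<close> except the
  shared vertex, for which a weak inequality between the link sizes suffices, or the same set without
  the next path vertex, for which the inequality has to be strict. The second
  serves to attach a further link, so strictness is asked of the links before the last.\<close>

lemma chain_ekr_centre:
  assumes G: "is_chain G n v W" and "1 \<le> k" "k \<le> n"
    and strict: "\<And>i. 1 \<le> i \<Longrightarrow> Suc i < n \<Longrightarrow> card (link v W i) < card (link v W (Suc i))"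
    and weak: "\<And>i. 1 \<le> i \<Longrightarrow> Suc i = n \<Longrightarrow> card (link v W i) \<le> card (link v W (Suc i))"
  defines "U \<equiv> \<lambda>k. \<Union>i\<in>{1..k}. link v W i"
  shows "ekr_centre (parcs G) (U k) (v 1) \<and>
         (k < n \<longrightarrow> ekr_centre (parcs G) (U k - {v (Suc k)}) (v 1))"
  using \<open>1 \<le> k\<close> \<open>k \<le> n\<close>
proof (induction k rule: dec_induct)
  case base
  have "(y, z) \<in> parcs G" if "y \<in> link v W 1" "z \<in> link v W 1" "y \<noteq> z" for y z
    using that base by (auto simp: chain_arcs[OF G] intro!: bexI[of _ 1])
  moreover have "(v 1, v 1) \<notin> parcs G" by (simp add: chain_arcs[OF G])
  moreover have "finite (link v W 1)" using finite_chain_link[OF G, of 1] base by simp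
  moreover have "v 1 \<noteq> v (Suc 1)" using chain_inj[OF G, of 1 "Suc 1"] base by auto
  moreover have "v 1 \<in> link v W 1" by (simp add: link_def)
  moreover have "U 1 = link v W 1" by (simp add: U_def)
  ultimately show ?case by (auto intro!: clique_ekr_centre)
next
  case (step k)
  let ?c = "v (Suc k)" and ?d = "v (Suc (Suc k))"
  have k: "1 \<le> k" "k < n" using step by auto
  let ?B = "link v W (Suc k) - {?c}"
  note fin = finite_chain_link[OF G]
  have in_links: "?c \<in> link v W k" "?c \<in> link v W (Suc k)" "?d \<in> link v W (Suc k)"
    by (auto simp: link_def)
  have "?c \<noteq> ?d"
    using chain_inj[OF G, of "Suc k" "Suc (Suc k)"] k by auto
  have U: "U (Suc k) = U k \<union> ?B"
    using k in_links by (auto simp: U_def atLeastAtMostSuc_conv)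
  have "?d \<notin> U k"
  proof
    assume "?d \<in> U k"
    then obtain i where i: "i \<in> {1..k}" "?d \<in> link v W i" by (auto simp: U_def)
    then show False using chain_links_inter[OF G, of i "Suc k" ?d] in_links k \<open>?c \<noteq> ?d\<close> by auto
  qed
  then have U': "U (Suc k) - {?d} = U k \<union> (?B - {?d})" using U by auto
  have IH: "ekr_centre (parcs G) (U k) (v 1)" "ekr_centre (parcs G) (U k - {?c}) (v 1)"
    using step.IH k by auto
  have attach: "ekr_centre (parcs G) (U k \<union> B) (v 1)"
    if "B \<subseteq> ?B" "card (link v W k - {?c}) \<le> card B" for B
    using chain_attach_to_link[OF G k that] IH by (simp add: U_def)
  have cards: "card (link v W k - {?c}) = card (link v W k) - 1"
    "card ?B = card (link v W (Suc k)) - 1" "card (?B - {?d}) = card (link v W (Suc k)) - 2"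
    using fin k in_links \<open>?c \<noteq> ?d\<close> by auto
  have "ekr_centre (parcs G) (U (Suc k)) (v 1)"
    unfolding U
  proof (rule attach)
    have "card (link v W k) \<le> card (link v W (Suc k))"
      using strict[of k] weak[of k] k by (cases "Suc k = n") auto
    then show "card (link v W k - {?c}) \<le> card ?B" using cards by simp
  qed simp
  moreover have "ekr_centre (parcs G) (U (Suc k) - {?d}) (v 1)" if "Suc k < n"
    unfolding U'
  proof (rule attach)
    show "card (link v W k - {?c}) \<le> card (?B - {?d})" using strict[of k] that k cards by linarith
  qed blast
  ultimately show ?case by simp
qed

theorem theorem1p23:
  fixes G :: "'a pair_pre_digraph"
  assumes "special_chain G"
  shows "\<forall>r\<ge>1. r_EKR r G"
proof -
  from assms obtain n v W where chain: "is_chain G n v W \<and> (n \<in> {0, 1} \<or> n \<ge> 2 \<and>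
         (\<forall>i\<in>{2..n - 1}. card (link v W i) \<ge> card (link v W (i - 1)) + 1) \<and>
         card (link v W n) \<ge> card (link v W (n - 1)))"
    unfolding special_chain_def by (elim exE)
  note G = conjunct1[OF chain] and special = conjunct2[OF chain]
  note verts = chain_verts[OF G]
  have fin: "finite (pverts G)" by (rule finite_chain_verts[OF G])
  have v1: "v 1 \<in> pverts G" unfolding verts by auto
  have "ekr_centre (parcs G) (pverts G) (v 1)"
  proof (cases "n = 0")
    case True
    then have "pverts G = {v 1}" by (simp add: verts)
    then show ?thesis by (auto intro!: clique_ekr_centre simp: chain_arcs[OF G])
  next
    case False
    have strict: "card (link v W i) < card (link v W (Suc i))" if "1 \<le> i" "Suc i < n" for i
    proof -
      have "Suc i \<in> {2..n - 1}" using that by auto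
      then have "card (link v W (Suc i - 1)) + 1 \<le> card (link v W (Suc i))"
        using special that by blast
      then show ?thesis by simp
    qed
    have weak: "card (link v W i) \<le> card (link v W (Suc i))" if "1 \<le> i" "Suc i = n" for i
      using special that by auto
    have "pverts G = (\<Union>i\<in>{1..n}. link v W i)"
    proof
      have "v j \<in> (\<Union>i\<in>{1..n}. link v W i)" if "j \<in> {1..n + 1}" for j
      proof (cases "j \<le> n")
        case True
        then show ?thesis using that by (auto simp: link_def)
      next
        case False
        then have "j = Suc n" using that by auto
        then show ?thesis using \<open>n \<noteq> 0\<close> by (auto simp: link_def intro!: bexI[of _ n])
      qed
      then show "pverts G \<subseteq> (\<Union>i\<in>{1..n}. link v W i)"
        unfolding verts by (auto simp: link_def)
    qed (auto simp: verts link_def)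
    moreover have "1 \<le> n" using False by simp
    note chain_ekr_centre[OF G this order_refl]
    then have "ekr_centre (parcs G) (\<Union>i\<in>{1..n}. link v W i) (v 1)"
      using strict weak by blast
    ultimately show ?thesis by simp
  qed
  then have "r_EKR r G" for r by (rule r_EKR_if_ekr_centre[OF fin v1])
  then show ?thesis by blast
qed

end
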